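(* Suppose $\mathcal{U}$ and $\mathcal{U}_n$ ($n<\omega$) are ultrafilters on $\omega$, each basically generated by a filter base which is closed under finite intersections. Then $\mathcal{V}=\lim_{n\to\mathcal{U}}\mathcal{U}_n$ is basically generated by a filter base which is closed under finite intersections. Consequently, the class of ultrafilters basically generated by some filter base closed under finite intersections is closed under Fubini products.
   Context: An ultrafilter $\mathcal{W}$ on a countable set $S$ is basically generated if it has a filter base $\mathcal{B}\subseteq\mathcal{W}$ (for every $A\in\mathcal{W}$ there is $B\in\mathcal{B}$ with $B\subseteq A$) such that every sequence $(A_n)_{n<\omega}\subseteq\mathcal{B}$ converging (in the Cantor topology on $\mathcal{P}(S)$, i.e. pointwise convergence of characteristic functions) to an element of $\mathcal{B}$ has a subsequence $(A_{n_k})_{k<\omega}$ with $\bigcap_k A_{n_k}\in\mathcal{W}$. For ultrafilters $\mathcal{U},\mathcal{U}_n$ on $\omega$, $\lim_{n\to\mathcal{U}}\mathcal{U}_n$ is the ultrafilter on $\omega\times\omega$ consisting of all $A\subseteq\omega\times\omega$ such that $\{n:\{j:(n,j)\in A\}\in\mathcal{U}_n\}\in\mathcal{U}$; the Fubini product $\mathcal{U}\cdot\mathcal{V}$ is $\lim_{n\to\mathcal{U}}\mathcal{V}$. (Ultrafilters on $\omega\times\omega$ are identified with ultrafilters on $\omega$ via a bijection.) *)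

theory Defs
  imports "HOL-Analysis.Analysis"
begin

(* Ultrafilters are proper filters containing every set or its complement; principal ones are
   allowed.  In the library's order bot is the improper filter. *)

definition ultrafilter :: "'a filter \<Rightarrow> bool" where
  "ultrafilter W \<longleftrightarrow>
     W \<noteq> bot \<and> (\<forall>P. (\<forall>\<^sub>F x in W. P x) \<or> (\<forall>\<^sub>F x in W. \<not> P x))"

definition filter_sets :: "'a filter \<Rightarrow> 'a set set" where
  "filter_sets W = {A. \<forall>\<^sub>F x in W. x \<in> A}"

definition filter_base :: "'a filter \<Rightarrow> 'a set set \<Rightarrow> bool" where
  "filter_base W \<B> \<longleftrightarrow>
     \<B> \<subseteq> filter_sets W \<and> (\<forall>A\<in>filter_sets W. \<exists>B\<in>\<B>. B \<subseteq> A)"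

(* The limit is taken in the library's product topology on functions into the discrete space
   bool, i.e. in the Cantor topology; cantor_tendsto_iff below is the pointwise form. *)

definition cantor_tendsto :: "(nat \<Rightarrow> 'a set) \<Rightarrow> 'a set \<Rightarrow> bool" where
  "cantor_tendsto A B \<longleftrightarrow> (\<lambda>n x. x \<in> A n) \<longlonglongrightarrow> (\<lambda>x. x \<in> B)"

definition basically_generated_by :: "'a filter \<Rightarrow> 'a set set \<Rightarrow> bool" where
  "basically_generated_by W \<B> \<longleftrightarrow>
     ultrafilter W \<and> filter_base W \<B> \<and>
     (\<forall>A B. (\<forall>n. A n \<in> \<B>) \<and> B \<in> \<B> \<and> cantor_tendsto A B \<longrightarrow>
        (\<exists>r :: nat \<Rightarrow> nat. strict_mono r \<and> (\<Inter>k. A (r k)) \<in> filter_sets W))"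

(* The empty intersection is excluded: the whole space need not belong to the base. *)

definition closed_under_finite_inters :: "'a set set \<Rightarrow> bool" where
  "closed_under_finite_inters \<B> \<longleftrightarrow>
     (\<forall>\<F>. finite \<F> \<and> \<F> \<noteq> {} \<and> \<F> \<subseteq> \<B> \<longrightarrow> \<Inter>\<F> \<in> \<B>)"

definition basically_generated_inter_closed :: "'a filter \<Rightarrow> bool" where
  "basically_generated_inter_closed W \<longleftrightarrow>
     (\<exists>\<B>. basically_generated_by W \<B> \<and> closed_under_finite_inters \<B>)"

(* filter_sets of the limit is computed in filter_sets_ultrafilter_lim below. *)

definition ultrafilter_lim :: "'a filter \<Rightarrow> ('a \<Rightarrow> 'b filter) \<Rightarrow> ('a \<times> 'b) filter" where
  "ultrafilter_lim U V = Abs_filter (\<lambda>P. \<forall>\<^sub>F n in U. \<forall>\<^sub>F j in V n. P (n, j))"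

(* Not the library's product filter, which is generated by rectangles and is in general
   not an ultrafilter. *)

definition fubini_product :: "'a filter \<Rightarrow> 'b filter \<Rightarrow> ('a \<times> 'b) filter" where
  "fubini_product U V = ultrafilter_lim U (\<lambda>_. V)"

lemma cantor_tendsto_iff:
  "cantor_tendsto A B \<longleftrightarrow> (\<forall>x. \<forall>\<^sub>F n in sequentially. x \<in> A n \<longleftrightarrow> x \<in> B)"
proof -
  have "cantor_tendsto A B \<longleftrightarrow>
      limitin (product_topology (\<lambda>_. euclidean) UNIV) (\<lambda>n x. x \<in> A n) (\<lambda>x. x \<in> B) sequentially"
    unfolding cantor_tendsto_def limitin_canonical_iff[symmetric] euclidean_product_topology ..
  also have "\<dots> \<longleftrightarrow> (\<forall>x. (\<lambda>n. x \<in> A n) \<longlonglongrightarrow> (x \<in> B))"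
    by (simp add: limitin_componentwise)
  finally show ?thesis
    by (simp add: tendsto_discrete)
qed

lemma eventually_ultrafilter_lim:
  "eventually P (ultrafilter_lim U V) \<longleftrightarrow> (\<forall>\<^sub>F n in U. \<forall>\<^sub>F j in V n. P (n, j))"
  unfolding ultrafilter_lim_def
proof (rule eventually_Abs_filter, rule is_filter.intro)
  fix P Q :: "'a \<times> 'b \<Rightarrow> bool"
  assume "\<forall>\<^sub>F n in U. \<forall>\<^sub>F j in V n. P (n, j)" "\<forall>\<^sub>F n in U. \<forall>\<^sub>F j in V n. Q (n, j)"
  then show "\<forall>\<^sub>F n in U. \<forall>\<^sub>F j in V n. P (n, j) \<and> Q (n, j)"
    by eventually_elim (rule eventually_conj)
next
  fix P Q :: "'a \<times> 'b \<Rightarrow> bool"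
  assume *: "\<forall>x. P x \<longrightarrow> Q x" and "\<forall>\<^sub>F n in U. \<forall>\<^sub>F j in V n. P (n, j)"
  from this(2) show "\<forall>\<^sub>F n in U. \<forall>\<^sub>F j in V n. Q (n, j)"
    by (rule eventually_mono) (use * in \<open>auto elim: eventually_mono\<close>)
qed simp

lemma filter_sets_ultrafilter_lim:
  "filter_sets (ultrafilter_lim U V) =
     {A. {n. {j. (n, j) \<in> A} \<in> filter_sets (V n)} \<in> filter_sets U}"
  by (simp add: filter_sets_def eventually_ultrafilter_lim)

end

(* Let B and C n be the given bases of U and V n.  The limit gets the base of all A whose domain
   lies in B and whose section over every n in the domain lies in C n; it inherits closure under
   intersections because two members of C n always meet.  If A k converges to L in this base, the
   domains need not converge: the section of A k over some n outside Domain L may be nonempty for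
   infinitely many k.  But the sets Domain (A k) \<inter> Domain L lie in B, by closure, and do converge to
   Domain L.  So along a subsequence they have an intersection D in U.  Over each n in D the
   sections converge inside C n, so a diagonal subsequence has, over every n in D, all but
   finitely many of its sections contained in a sequence with intersection in V n; the finitely
   many remaining sections lie in V n as well. *)

theory Submission
  imports Defs "HOL-Library.Diagonal_Subsequence"
begin

section \<open>Sets of a filter, of its images and of limits\<close>

lemma filter_sets_mono: "A \<in> filter_sets W \<Longrightarrow> A \<subseteq> B \<Longrightarrow> B \<in> filter_sets W"
  unfolding filter_sets_def by (auto elim: eventually_mono)

lemma filter_sets_Int: "A \<in> filter_sets W \<Longrightarrow> B \<in> filter_sets W \<Longrightarrow> A \<inter> B \<in> filter_sets W"
  unfolding filter_sets_def by (simp add: eventually_conj)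

lemma filter_sets_finite_INT:
  "finite I \<Longrightarrow> (\<And>i. i \<in> I \<Longrightarrow> A i \<in> filter_sets W) \<Longrightarrow> (\<Inter>i\<in>I. A i) \<in> filter_sets W"
  unfolding filter_sets_def by (simp add: eventually_ball_finite)

lemma filter_sets_nonempty: "ultrafilter W \<Longrightarrow> A \<in> filter_sets W \<Longrightarrow> A \<noteq> {}"
  by (auto simp: ultrafilter_def filter_sets_def eventually_False)

lemma filter_sets_filtermap: "A \<in> filter_sets (filtermap e W) \<longleftrightarrow> e -` A \<in> filter_sets W"
  by (simp add: filter_sets_def eventually_filtermap)

lemma filter_sets_ultrafilter_lim_iff:
  "A \<in> filter_sets (ultrafilter_lim U V) \<longleftrightarrow> {n. A `` {n} \<in> filter_sets (V n)} \<in> filter_sets U"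
  by (simp add: filter_sets_ultrafilter_lim Image_singleton)

text \<open>For an ultrafilter the quantifier \<open>\<forall>\<^sub>F\<close> commutes with
  negation. Pushing a negation first through \<open>U\<close> and then through each
  \<open>V n\<close> turns failure of \<open>P\<close> in the limit into largeness of its
  complement.\<close>

lemma ultrafilter_ultrafilter_lim:
  assumes "ultrafilter U" and V: "\<And>n. ultrafilter (V n)"
  shows "ultrafilter (ultrafilter_lim U V)"
  unfolding ultrafilter_def
proof (intro conjI allI)
  have "\<not> (\<forall>\<^sub>F x in ultrafilter_lim U V. False)"
    unfolding eventually_ultrafilter_lim using assms by (simp add: ultrafilter_def)
  then show "ultrafilter_lim U V \<noteq> bot" by auto
next
  fix P :: "'a \<times> 'b \<Rightarrow> bool"
  have "(\<forall>\<^sub>F n in U. \<forall>\<^sub>F j in V n. P (n, j)) \<or> (\<forall>\<^sub>F n in U. \<not> (\<forall>\<^sub>F j in V n. P (n, j)))"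
    using assms(1) by (simp add: ultrafilter_def)
  moreover have "\<forall>\<^sub>F j in V n. \<not> P (n, j)" if "\<not> (\<forall>\<^sub>F j in V n. P (n, j))" for n
    using V[of n] that unfolding ultrafilter_def by metis
  ultimately show "(\<forall>\<^sub>F x in ultrafilter_lim U V. P x) \<or> (\<forall>\<^sub>F x in ultrafilter_lim U V. \<not> P x)"
    unfolding eventually_ultrafilter_lim by (metis (mono_tags, lifting) eventually_mono)
qed

lemma ultrafilter_filtermap: "ultrafilter W \<Longrightarrow> ultrafilter (filtermap e W)"
  by (simp add: ultrafilter_def eventually_filtermap filtermap_bot_iff)

lemma closed_under_finite_inters_iff:
  "closed_under_finite_inters \<B> \<longleftrightarrow> (\<forall>A\<in>\<B>. \<forall>B\<in>\<B>. A \<inter> B \<in> \<B>)"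
proof (intro iffI ballI)
  fix A B assume cl: "closed_under_finite_inters \<B>" and "A \<in> \<B>" "B \<in> \<B>"
  then show "A \<inter> B \<in> \<B>"
    using cl[unfolded closed_under_finite_inters_def, rule_format, of "{A, B}"] by simp
next
  assume *: "\<forall>A\<in>\<B>. \<forall>B\<in>\<B>. A \<inter> B \<in> \<B>"
  have "\<Inter>\<F> \<in> \<B>" if "finite \<F>" "\<F> \<noteq> {}" "\<F> \<subseteq> \<B>" for \<F>
    using that by (induction rule: finite_ne_induct) (use * in auto)
  then show "closed_under_finite_inters \<B>"
    by (simp add: closed_under_finite_inters_def)
qed

section \<open>Convergence in the Cantor topology\<close>

lemma cantor_tendsto_subseq:
  assumes "cantor_tendsto A B" "strict_mono r"
  shows "cantor_tendsto (\<lambda>n. A (r n)) B"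
  using assms unfolding cantor_tendsto_iff by (auto intro: eventually_subseq)

lemma cantor_tendsto_vimage: "cantor_tendsto A B \<Longrightarrow> cantor_tendsto (\<lambda>n. e -` A n) (e -` B)"
  by (simp add: cantor_tendsto_iff)

lemma cantor_tendsto_Image_singleton:
  "cantor_tendsto A B \<Longrightarrow> cantor_tendsto (\<lambda>k. A k `` {n}) (B `` {n})"
  by (simp add: cantor_tendsto_iff)

text \<open>A point of \<open>Domain B\<close> has a fixed witnessing pair in \<open>B\<close>, and
  that single pair lies in \<open>A k\<close> for almost all k. Outside \<open>Domain B\<close> no
  such pair is available to control \<open>Domain (A k)\<close>, so those points are cut off by the
  intersection.\<close>

lemma cantor_tendsto_Domain_Int:
  assumes "cantor_tendsto A B"
  shows "cantor_tendsto (\<lambda>k. Domain (A k) \<inter> Domain B) (Domain B)"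
  unfolding cantor_tendsto_iff
proof
  fix n
  show "\<forall>\<^sub>F k in sequentially. n \<in> Domain (A k) \<inter> Domain B \<longleftrightarrow> n \<in> Domain B"
  proof (cases "n \<in> Domain B")
    case True
    then obtain j where j: "(n, j) \<in> B" by blast
    from assms have "\<forall>\<^sub>F k in sequentially. (n, j) \<in> A k \<longleftrightarrow> (n, j) \<in> B"
      unfolding cantor_tendsto_iff by blast
    then show ?thesis
      by eventually_elim (use j in blast)
  qed simp
qed

section \<open>The base of the limit\<close>

definition lim_base :: "'a set set \<Rightarrow> ('a \<Rightarrow> 'b set set) \<Rightarrow> ('a \<times> 'b) set set" where
  "lim_base \<B> \<C> = {A. Domain A \<in> \<B> \<and> (\<forall>n\<in>Domain A. A `` {n} \<in> \<C> n)}"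

lemma filter_base_lim_base:
  assumes U: "filter_base U \<B>"
    and V: "\<And>n. ultrafilter (V n)" "\<And>n. filter_base (V n) (\<C> n)"
  shows "filter_base (ultrafilter_lim U V) (lim_base \<B> \<C>)"
  unfolding filter_base_def
proof (intro conjI subsetI ballI)
  fix A assume A: "A \<in> lim_base \<B> \<C>"
  then have "Domain A \<in> filter_sets U"
    using U by (auto simp: lim_base_def filter_base_def)
  moreover have "Domain A \<subseteq> {n. A `` {n} \<in> filter_sets (V n)}"
    using A V(2) unfolding lim_base_def filter_base_def by blast
  ultimately show "A \<in> filter_sets (ultrafilter_lim U V)"
    unfolding filter_sets_ultrafilter_lim_iff by (rule filter_sets_mono)
next
  fix A assume "A \<in> filter_sets (ultrafilter_lim U V)"
  \<comment> \<open>Shrinking happens in two stages: first the set of indices with large sections to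
    a member \<open>D\<close> of \<B>, then each section over \<open>D\<close> to a member of
    \<open>\<C> n\<close>.\<close>
  then obtain D where D: "D \<in> \<B>" "D \<subseteq> {n. A `` {n} \<in> filter_sets (V n)}"
    using U unfolding filter_sets_ultrafilter_lim_iff filter_base_def by blast
  then have "\<forall>n\<in>D. \<exists>C\<in>\<C> n. C \<subseteq> A `` {n}"
    using V(2) unfolding filter_base_def by blast
  then obtain C where C: "\<And>n. n \<in> D \<Longrightarrow> C n \<in> \<C> n" "\<And>n. n \<in> D \<Longrightarrow> C n \<subseteq> A `` {n}"
    by metis
  \<comment> \<open>An empty \<open>C n\<close> would drop n from the domain of
    \<open>Sigma D C\<close>, and that domain has to be exactly \<open>D\<close> to be in
    \<B>.\<close>
  have "C n \<noteq> {}" if "n \<in> D" for n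
    using C(1)[OF that] V(2)[of n] filter_sets_nonempty[OF V(1)] by (auto simp: filter_base_def)
  then have "Domain (Sigma D C) = D" by blast
  moreover have "Sigma D C `` {n} = C n" if "n \<in> D" for n
    using that by blast
  ultimately have "Sigma D C \<in> lim_base \<B> \<C>"
    using C(1) D(1) by (simp add: lim_base_def)
  moreover have "Sigma D C \<subseteq> A"
    using C(2) by blast
  ultimately show "\<exists>B\<in>lim_base \<B> \<C>. B \<subseteq> A" by blast
qed

lemma closed_under_finite_inters_lim_base:
  assumes \<B>: "closed_under_finite_inters \<B>"
    and \<C>: "\<And>n. closed_under_finite_inters (\<C> n)" "\<And>n. {} \<notin> \<C> n"
  shows "closed_under_finite_inters (lim_base \<B> \<C>)"
  unfolding closed_under_finite_inters_iff
proof (intro ballI)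
  fix A B assume A: "A \<in> lim_base \<B> \<C>" and B: "B \<in> lim_base \<B> \<C>"
  have sec: "(A \<inter> B) `` {n} \<in> \<C> n" if "n \<in> Domain A \<inter> Domain B" for n
  proof -
    have "A `` {n} \<inter> B `` {n} \<in> \<C> n"
      using A B that \<C>(1)[of n] by (auto simp: lim_base_def closed_under_finite_inters_iff)
    moreover have "(A \<inter> B) `` {n} = A `` {n} \<inter> B `` {n}" by blast
    ultimately show ?thesis by simp
  qed
  \<comment> \<open>Nonempty sections keep every common index in the domain. Otherwise
    \<open>Domain (A \<inter> B)\<close> could be a proper subset of the intersection of the
    domains, about which closure of \<B> says nothing.\<close>
  then have "(A \<inter> B) `` {n} \<noteq> {}" if "n \<in> Domain A \<inter> Domain B" for n
    using \<C>(2) that by metis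
  then have "Domain (A \<inter> B) = Domain A \<inter> Domain B" by blast
  moreover have "Domain A \<inter> Domain B \<in> \<B>"
    using A B \<B> by (auto simp: lim_base_def closed_under_finite_inters_iff)
  ultimately show "A \<inter> B \<in> lim_base \<B> \<C>"
    using sec by (simp add: lim_base_def)
qed

section \<open>Subsequences with large intersection\<close>

lemma basically_generated_by_subseq:
  assumes "basically_generated_by W \<B>" "\<And>n. A n \<in> \<B>" "B \<in> \<B>" "cantor_tendsto A B"
  obtains r :: "nat \<Rightarrow> nat" where "strict_mono r" "(\<Inter>k. A (r k)) \<in> filter_sets W"
  using assms unfolding basically_generated_by_def by blast

text \<open>There is one condition for each natural number n in \<open>D\<close>, and it survives
  passing to a further subsequence, so the countably many conditions can be met in turn and combined
  diagonally.\<close>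

lemma diagonal_sections:
  fixes V :: "nat \<Rightarrow> 'b filter"
  assumes V: "\<And>n. basically_generated_by (V n) (\<C> n)"
    and A: "\<And>k n. n \<in> D \<Longrightarrow> A k `` {n} \<in> \<C> n"
    and L: "\<And>n. n \<in> D \<Longrightarrow> L `` {n} \<in> \<C> n" "cantor_tendsto A L"
  obtains r :: "nat \<Rightarrow> nat" where "strict_mono r"
    "\<And>n. n \<in> D \<Longrightarrow> (\<Inter>k. A (r k)) `` {n} \<in> filter_sets (V n)"
proof -
  \<comment> \<open>The diagonal construction asks for a condition at every natural number; the
    guard makes it trivial outside \<open>D\<close>.\<close>
  define P where "P n s \<longleftrightarrow> (n \<in> D \<longrightarrow> (\<Inter>k. A (s k) `` {n}) \<in> filter_sets (V n))"
    for n and s :: "nat \<Rightarrow> nat"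
  interpret subseqs P
  proof
    fix n :: nat and s :: "nat \<Rightarrow> nat"
    assume s: "strict_mono s"
    show "\<exists>r'. strict_mono r' \<and> P n (s \<circ> r')"
    proof (cases "n \<in> D")
      case True
      have lim: "cantor_tendsto (\<lambda>k. A (s k) `` {n}) (L `` {n})"
        by (rule cantor_tendsto_Image_singleton[OF cantor_tendsto_subseq[OF L(2) s]])
      obtain r' :: "nat \<Rightarrow> nat"
        where "strict_mono r'" "(\<Inter>k. A (s (r' k)) `` {n}) \<in> filter_sets (V n)"
        by (rule basically_generated_by_subseq[OF V[of n] _ _ lim]) (use A L(1) True in simp_all)
      then show ?thesis by (auto simp: P_def)
    qed (auto simp: P_def intro: strict_mono_id)
  qed
  have "(\<Inter>k. A (diagseq k)) `` {n} \<in> filter_sets (V n)" if n: "n \<in> D" for n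
  proof -
    \<comment> \<open>The stage that secures condition n produces the sequence numbered
      \<open>Suc n\<close>, and the diagonal is a subsequence of it only from index
      \<open>Suc n\<close> on. Stability under subsequences holds because an intersection over fewer
      sets is larger.\<close>
    have "P n (diagseq \<circ> ((+) (Suc n)))"
    proof (rule diagseq_holds)
      fix m :: nat and s r :: "nat \<Rightarrow> nat"
      assume "P m s"
      moreover have "(\<Inter>k. A (s k) `` {m}) \<subseteq> (\<Inter>k. A (s (r k)) `` {m})" by blast
      ultimately show "P m (s \<circ> r)"
        by (auto simp: P_def intro: filter_sets_mono)
    qed
    then have "(\<Inter>k. A (diagseq (Suc n + k)) `` {n}) \<in> filter_sets (V n)"
      using n by (simp add: P_def)
    \<comment> \<open>These are precisely the indices missed by the shift by
      \<open>Suc n\<close>.\<close>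
    moreover have "(\<Inter>k\<in>{..n}. A (diagseq k) `` {n}) \<in> filter_sets (V n)"
      using A[OF n] V[of n]
      by (intro filter_sets_finite_INT) (auto simp: basically_generated_by_def filter_base_def)
    ultimately have "(\<Inter>k\<in>{..n}. A (diagseq k) `` {n}) \<inter> (\<Inter>k. A (diagseq (Suc n + k)) `` {n})
        \<in> filter_sets (V n)"
      by (intro filter_sets_Int)
    then show ?thesis
    proof (rule filter_sets_mono, intro subsetI)
      fix j
      assume j: "j \<in> (\<Inter>k\<in>{..n}. A (diagseq k) `` {n}) \<inter> (\<Inter>k. A (diagseq (Suc n + k)) `` {n})"
      have "(n, j) \<in> A (diagseq k)" for k
      proof (cases "k \<le> n")
        case False
        then obtain i where "k = Suc n + i"
          using nat_le_iff_add[of "Suc n" k] by auto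
        then show ?thesis using j by blast
      qed (use j in blast)
      then show "j \<in> (\<Inter>k. A (diagseq k)) `` {n}" by blast
    qed
  qed
  with subseq_diagseq show thesis by (rule that)
qed

lemma basically_generated_by_ultrafilter_lim:
  fixes V :: "nat \<Rightarrow> 'b filter"
  assumes U: "basically_generated_by U \<B>" "closed_under_finite_inters \<B>"
    and V: "\<And>n. basically_generated_by (V n) (\<C> n)"
  shows "basically_generated_by (ultrafilter_lim U V) (lim_base \<B> \<C>)"
  unfolding basically_generated_by_def
proof (intro conjI allI impI)
  show "ultrafilter (ultrafilter_lim U V)"
    using U(1) V by (intro ultrafilter_ultrafilter_lim) (auto simp: basically_generated_by_def)
  show "filter_base (ultrafilter_lim U V) (lim_base \<B> \<C>)"
    using U(1) V by (intro filter_base_lim_base) (auto simp: basically_generated_by_def)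
next
  fix A L
  assume "(\<forall>k. A k \<in> lim_base \<B> \<C>) \<and> L \<in> lim_base \<B> \<C> \<and> cantor_tendsto A L"
  then have A: "\<And>k. A k \<in> lim_base \<B> \<C>" and L: "L \<in> lim_base \<B> \<C>" and lim: "cantor_tendsto A L"
    by auto
  have "Domain (A k) \<inter> Domain L \<in> \<B>" for k
    using A[of k] L U(2) by (simp add: lim_base_def closed_under_finite_inters_iff)
  then obtain r :: "nat \<Rightarrow> nat" where r: "strict_mono r"
    and D: "(\<Inter>k. Domain (A (r k)) \<inter> Domain L) \<in> filter_sets U" (is "?D \<in> _")
    using basically_generated_by_subseq[OF U(1) _ _ cantor_tendsto_Domain_Int[OF lim]] L
    by (auto simp: lim_base_def)
  \<comment> \<open>An n in \<open>?D\<close> lies in \<open>Domain L\<close> and in every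
    \<open>Domain (A (r k))\<close>, which is the condition under which membership in the base says
    something about the sections over n.\<close>
  have sections: "A (r k) `` {n} \<in> \<C> n" "L `` {n} \<in> \<C> n" if "n \<in> ?D" for k n
    using that A[of "r k"] L by (auto simp: lim_base_def)
  obtain s :: "nat \<Rightarrow> nat" where s: "strict_mono s"
    and sec: "\<And>n. n \<in> ?D \<Longrightarrow> (\<Inter>k. A (r (s k))) `` {n} \<in> filter_sets (V n)"
    by (rule diagonal_sections[where D = ?D and A = "\<lambda>k. A (r k)", OF V sections
          cantor_tendsto_subseq[OF lim r]]) (assumption+, rule that)
  have "?D \<subseteq> {n. (\<Inter>k. A (r (s k))) `` {n} \<in> filter_sets (V n)}"
    using sec by blast
  with D have inter: "(\<Inter>k. A ((r \<circ> s) k)) \<in> filter_sets (ultrafilter_lim U V)"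
    unfolding filter_sets_ultrafilter_lim_iff o_apply by (rule filter_sets_mono)
  show "\<exists>r :: nat \<Rightarrow> nat. strict_mono r \<and> (\<Inter>k. A (r k)) \<in> filter_sets (ultrafilter_lim U V)"
    by (intro exI[of _ "r \<circ> s"] conjI strict_mono_o r s inter)
qed

section \<open>Closure under limits and transport along injections\<close>

lemma basically_generated_inter_closed_ultrafilter_lim:
  fixes V :: "nat \<Rightarrow> 'b filter"
  assumes "basically_generated_inter_closed U" and "\<And>n. basically_generated_inter_closed (V n)"
  shows "basically_generated_inter_closed (ultrafilter_lim U V)"
proof -
  obtain \<B> where \<B>: "basically_generated_by U \<B>" "closed_under_finite_inters \<B>"
    using assms(1) unfolding basically_generated_inter_closed_def by blast
  obtain \<C> where \<C>: "\<And>n. basically_generated_by (V n) (\<C> n)"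
    "\<And>n. closed_under_finite_inters (\<C> n)"
    using assms(2) unfolding basically_generated_inter_closed_def by metis
  \<comment> \<open>Members of \<open>\<C> n\<close> belong to the proper filter
    \<open>V n\<close>.\<close>
  have "{} \<notin> \<C> n" for n
    using \<C>(1)[of n] filter_sets_nonempty
    by (auto simp: basically_generated_by_def filter_base_def)
  then have "closed_under_finite_inters (lim_base \<B> \<C>)"
    by (intro closed_under_finite_inters_lim_base \<B> \<C>)
  moreover have "basically_generated_by (ultrafilter_lim U V) (lim_base \<B> \<C>)"
    by (intro basically_generated_by_ultrafilter_lim \<B> \<C>)
  ultimately show ?thesis
    unfolding basically_generated_inter_closed_def by blast
qed

text \<open>This serves the identification of pairs with natural numbers. Preimages under
  \<open>e\<close> commute with intersections and preserve pointwise convergence, so sequences are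
  pulled back to \<open>W\<close>. Injectivity gives that \<open>e\<close> followed by preimage
  restores each B in \<B>, so that the new family is cofinal in the image filter.\<close>

lemma basically_generated_inter_closed_filtermap:
  assumes W: "basically_generated_inter_closed W" and e: "inj e"
  shows "basically_generated_inter_closed (filtermap e W)"
proof -
  obtain \<B> where gen: "basically_generated_by W \<B>" and cl: "closed_under_finite_inters \<B>"
    using W unfolding basically_generated_inter_closed_def by blast
  have base: "filter_base W \<B>"
    using gen by (simp add: basically_generated_by_def)
  let ?\<B> = "{A. e -` A \<in> \<B>}"
  have "filter_base (filtermap e W) ?\<B>"
    unfolding filter_base_def
  proof (intro conjI subsetI ballI)
    show "A \<in> filter_sets (filtermap e W)" if "A \<in> ?\<B>" for A
      using that base by (auto simp: filter_base_def filter_sets_filtermap)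
  next
    fix A assume "A \<in> filter_sets (filtermap e W)"
    then obtain B where "B \<in> \<B>" "B \<subseteq> e -` A"
      using base by (auto simp: filter_base_def filter_sets_filtermap)
    then have "e ` B \<in> ?\<B>" "e ` B \<subseteq> A"
      using e by (auto simp: inj_vimage_image_eq)
    then show "\<exists>B\<in>?\<B>. B \<subseteq> A" by blast
  qed
  moreover have "\<exists>r :: nat \<Rightarrow> nat. strict_mono r \<and> (\<Inter>k. A (r k)) \<in> filter_sets (filtermap e W)"
    if A: "\<forall>n. A n \<in> ?\<B>" and B: "B \<in> ?\<B>" and lim: "cantor_tendsto A B" for A B
  proof -
    obtain r :: "nat \<Rightarrow> nat" where "strict_mono r" "(\<Inter>k. e -` A (r k)) \<in> filter_sets W"
      using basically_generated_by_subseq[OF gen _ _ cantor_tendsto_vimage[OF lim, of e]] A B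
      by auto
    then show ?thesis
      by (auto simp: filter_sets_filtermap vimage_INT)
  qed
  moreover have "ultrafilter (filtermap e W)"
    using gen by (simp add: basically_generated_by_def ultrafilter_filtermap)
  ultimately have "basically_generated_by (filtermap e W) ?\<B>"
    unfolding basically_generated_by_def by blast
  moreover have "closed_under_finite_inters ?\<B>"
    using cl by (simp add: closed_under_finite_inters_iff)
  ultimately show ?thesis
    unfolding basically_generated_inter_closed_def by blast
qed

theorem theorem16:
  shows "(\<forall>(U :: nat filter) (V :: nat \<Rightarrow> nat filter).
            basically_generated_inter_closed U \<and> (\<forall>n. basically_generated_inter_closed (V n)) \<longrightarrow>
            basically_generated_inter_closed (ultrafilter_lim U V))
       \<and> (\<forall>(U :: nat filter) (V :: nat filter).
            basically_generated_inter_closed U \<and> basically_generated_inter_closed V \<longrightarrow>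
            basically_generated_inter_closed (fubini_product U V) \<and>
            (\<forall>e :: nat \<times> nat \<Rightarrow> nat. bij e \<longrightarrow>
               basically_generated_inter_closed (filtermap e (fubini_product U V))))"
  \<comment> \<open>The product is the limit of a constant sequence, so the result on limits covers
    it; a bijection then transports it as an injection.\<close>
  unfolding fubini_product_def
  by (auto intro!: basically_generated_inter_closed_ultrafilter_lim
      basically_generated_inter_closed_filtermap bij_is_inj)

end
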